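(* Let $X$ be a complete $\mathrm{CAT}(0)$ space and $C \subseteq X$ a nonempty convex closed subset. Let $T,U:C \to C$ be nonexpansive mappings such that $F:=\mathrm{Fix}(T) \cap \mathrm{Fix}(U) \neq \emptyset$, and let $u,x_0 \in C$. Assume that $(\alpha_n)_{n\ge 0} \subset [0,1]$ and $(\beta_n)_{n\ge 0} \subset (0,1)$ are sequences of real numbers satisfying (i) $\lim \alpha_n =0$; (ii) $\sum_{n \geq 0} \alpha_n= \infty$; (iii) $\sum_{n \geq 0} |\alpha_{n+1} - \alpha_{n}|< \infty$; (iv) $\sum_{n \geq 0} |\beta_{n+1} - \beta_{n}|< \infty$; (v) $0< \liminf \beta_n \leq \limsup \beta_n <1$. Let $(x_n)$ be the sequence starting at $x_0$ and generated, for all $n\in\mathbb{N}$, by $$x_{2n+1}=(1-\alpha_n)T(x_{2n})\oplus \alpha_n u,\qquad x_{2n+2}=(1-\beta_n)U(x_{2n+1})\oplus\beta_nx_{2n+1}.$$ Then $(x_n)$ converges strongly (i.e. in the metric of $X$) to $P_F(u)$.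
   Context: A $\mathrm{CAT}(0)$ space is a metric space $(X,d)$ with a map $W:X\times X\times[0,1]\to X$ such that for all $x,y,z,w\in X$ and $\lambda,\lambda'\in[0,1]$: (W1) $d(z,W(x,y,\lambda))\le(1-\lambda)d(z,x)+\lambda d(z,y)$; (W2) $d(W(x,y,\lambda),W(x,y,\lambda'))=|\lambda-\lambda'|d(x,y)$; (W3) $W(x,y,\lambda)=W(y,x,1-\lambda)$; (W4) $d(W(x,y,\lambda),W(z,w,\lambda))\le(1-\lambda)d(x,z)+\lambda d(y,w)$; and (CN$^-$) $d^2(z,W(x,y,\tfrac12))\le\tfrac12d^2(z,x)+\tfrac12d^2(z,y)-\tfrac14d^2(x,y)$. One writes $(1-\lambda)x\oplus\lambda y:=W(x,y,\lambda)$. A subset $C\subseteq X$ is convex if $(1-\lambda)x\oplus\lambda y\in C$ for all $x,y\in C$, $\lambda\in[0,1]$. A map $T:C\to C$ is nonexpansive if $d(T(x),T(y))\le d(x,y)$ for all $x,y\in C$; $\mathrm{Fix}(T)$ is its set of fixed points. For a nonempty closed convex subset $S$ of a complete $\mathrm{CAT}(0)$ space and $u\in X$, the metric projection $P_S(u)$ is the unique point of $S$ with $d(u,P_S(u))=\min_{x\in S}d(u,x)$. *)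

theory Defs
  imports "HOL-Analysis.Analysis"
begin

(* The metric space X is a type of class metric_space; W x y l is the point written
   (1 - l) x (+) l y in the mathematical text. Only the values of W at parameters
   in [0,1] are constrained or used. *)
locale CAT0_space =
  fixes W :: "'a::metric_space \<Rightarrow> 'a \<Rightarrow> real \<Rightarrow> 'a"
  assumes W1: "l \<in> {0..1} \<Longrightarrow> dist z (W x y l) \<le> (1 - l) * dist z x + l * dist z y"
    and W2: "l \<in> {0..1} \<Longrightarrow> l' \<in> {0..1} \<Longrightarrow> dist (W x y l) (W x y l') = \<bar>l - l'\<bar> * dist x y"
    and W3: "l \<in> {0..1} \<Longrightarrow> W x y l = W y x (1 - l)"
    and W4: "l \<in> {0..1} \<Longrightarrow> dist (W x y l) (W z w l) \<le> (1 - l) * dist x z + l * dist y w"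
    and CN_minus: "(dist z (W x y (1/2)))\<^sup>2
        \<le> 1/2 * (dist z x)\<^sup>2 + 1/2 * (dist z y)\<^sup>2 - 1/4 * (dist x y)\<^sup>2"

definition W_convex :: "('a \<Rightarrow> 'a \<Rightarrow> real \<Rightarrow> 'a) \<Rightarrow> 'a set \<Rightarrow> bool" where
  "W_convex W C \<longleftrightarrow> (\<forall>x\<in>C. \<forall>y\<in>C. \<forall>l\<in>{0..1}. W x y l \<in> C)"

(* Maps C -> C are total functions mapping C into C; their values off C are irrelevant. *)
definition nonexpansive_on :: "'a::metric_space set \<Rightarrow> ('a \<Rightarrow> 'a) \<Rightarrow> bool" where
  "nonexpansive_on C T \<longleftrightarrow> T \<in> C \<rightarrow> C \<and> (\<forall>x\<in>C. \<forall>y\<in>C. dist (T x) (T y) \<le> dist x y)"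

definition Fix_on :: "'a set \<Rightarrow> ('a \<Rightarrow> 'a) \<Rightarrow> 'a set" where
  "Fix_on C T = {x \<in> C. T x = x}"

(* Meaningful when the nearest point exists and is unique, as it does for nonempty
   closed convex S in a complete CAT(0) space. *)
definition metric_projection :: "'a::metric_space set \<Rightarrow> 'a \<Rightarrow> 'a" where
  "metric_projection S u = (THE p. p \<in> S \<and> (\<forall>x\<in>S. dist u p \<le> dist u x))"

end

theory Submission
  imports Defs "HOL-Probability.Characteristic_Functions"
begin

text \<open>
  Write \<open>z n = x (2 n)\<close> and \<open>y n = x (2 n + 1)\<close>. The theorem combines three ideas.

  \<^item> Asymptotic regularity. All iterates stay within a bounded distance of a common fixed point.
    Nonexpansiveness turns the recursion into \<open>d (z (n+2)) (z (n+1)) \<le> (1 - \<alpha> (n+1)) d (z (n+1)) (z n)\<close>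
    plus a summable error, so consecutive even iterates approach each other
    (\<open>averaged_recursion_tendsto_zero\<close>). The strict convexity term \<open>l (1 - l) d\<^sup>2 x y\<close> of the
    quadratic inequality \<open>CN_inequality\<close>, applied to the step with \<open>U\<close>, then
    bounds \<open>\<beta> n (1 - \<beta> n) d\<^sup>2 (U (y n)) (y n)\<close> by quantities tending to 0. Hence the iterates are
    approximate fixed points of both maps, with an error tending to 0.

  \<^item> Approximate fixed points are asymptotically no closer to \<open>u\<close> than the projection \<open>p\<close> of \<open>u\<close> onto
    the set of common fixed points (\<open>nearest_common_fixed_point\<close>). Near-minimisers of the
    distance to \<open>u\<close> among \<open>\<epsilon>\<close>-approximate common fixed points form a Cauchy sequence as
    \<open>\<epsilon>\<close> tends to 0, because midpoints of approximate fixed points are again approximate fixed points;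
    the limit is \<open>p\<close>. This takes the place of a weak compactness argument, and also shows
    that \<open>p\<close> exists.

  \<^item> The quadratic inequality for the step with \<open>T\<close> gives
    \<open>d\<^sup>2 (z (n+1)) p \<le> (1 - \<alpha> n) d\<^sup>2 (z n) p + \<alpha> n (d\<^sup>2 u p - (1 - \<alpha> n) d\<^sup>2 u (T (z n)))\<close>. By the second
    idea the last bracket has a nonpositive limit superior, and the divergence of the
    sum of the \<open>\<alpha> n\<close> forces \<open>z n\<close>, and with it \<open>y n\<close>, to converge to \<open>p\<close>.
\<close>

section \<open>A recursive inequality for real sequences\<close>

text \<open>Past a late index the errors \<open>b\<close> and \<open>c\<close> contribute at most \<open>e\<close> each, and
  the weight of the starting value is a product of factors \<open>1 - a k \<le> exp (- a k)\<close>,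
  which divergence of the sum sends to 0.\<close>

lemma averaged_recursion_tendsto_zero:
  fixes s a b c :: "nat \<Rightarrow> real"
  assumes s: "\<And>n. 0 \<le> s n"
    and a: "\<And>n. a n \<in> {0..1}" "filterlim (\<lambda>N. \<Sum>n<N. a n) at_top sequentially"
    and b: "\<And>e. e > 0 \<Longrightarrow> \<forall>\<^sub>F n in sequentially. b n \<le> e"
    and c: "\<And>n. 0 \<le> c n" "summable c"
    and rec: "\<And>n. s (Suc n) \<le> (1 - a n) * s n + a n * b n + c n"
  shows "s \<longlonglongrightarrow> 0"
proof (rule LIMSEQ_I)
  fix r :: real assume "r > 0"
  define e where "e = r / 4"
  have e: "e > 0" using \<open>r > 0\<close> by (simp add: e_def)
  obtain N1 where N1: "\<And>n. n \<ge> N1 \<Longrightarrow> b n \<le> e"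
    using b[OF e] by (auto simp: eventually_sequentially)
  obtain N2 where N2: "\<And>m n. m \<ge> N2 \<Longrightarrow> norm (sum c {m..<n}) < e"
    using c(2) e unfolding summable_Cauchy by blast
  define N where "N = max N1 N2"
  have bound: "s (N + m) \<le> exp (- sum a {N..<N+m}) * s N + e + sum c {N..<N+m}" for m
  proof (induction m)
    case 0
    then show ?case using e by simp
  next
    case (Suc m)
    let ?n = "N + m"
    have "s (Suc ?n) \<le> (1 - a ?n) * s ?n + a ?n * b ?n + c ?n" by (rule rec)
    also have "\<dots> \<le> (1 - a ?n) * (exp (- sum a {N..<?n}) * s N + e + sum c {N..<?n})
        + a ?n * e + c ?n"
      using a(1)[of ?n] Suc N1[of ?n]
      by (intro add_mono mult_left_mono) (auto simp: N_def)
    also have "\<dots> = (1 - a ?n) * (exp (- sum a {N..<?n}) * s N) + e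
        + (1 - a ?n) * sum c {N..<?n} + c ?n"
      by (simp add: algebra_simps)
    also have "\<dots> \<le> exp (- a ?n) * (exp (- sum a {N..<?n}) * s N) + e
        + 1 * sum c {N..<?n} + c ?n"
      using a(1)[of ?n] exp_ge_add_one_self[of "- a ?n"] s[of N] c(1)
      by (intro add_mono mult_right_mono) (auto intro!: sum_nonneg)
    also have "\<dots> = exp (- sum a {N..<N + Suc m}) * s N + e + sum c {N..<N + Suc m}"
      by (simp add: exp_diff exp_minus field_simps)
    finally show ?case by simp
  qed
  have "filterlim (\<lambda>n. - (\<Sum>k<N. a k) + (\<Sum>k<n. a k)) at_top sequentially"
    by (rule filterlim_tendsto_add_at_top[OF tendsto_const a(2)])
  moreover have "\<forall>\<^sub>F n in sequentially. - (\<Sum>k<N. a k) + (\<Sum>k<n. a k) = sum a {N..<n}"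
    using eventually_ge_at_top[of N]
  proof eventually_elim
    case (elim n)
    have "sum a {..<n} = sum a {..<N} + sum a {N..<n}"
      using elim sum.atLeastLessThan_concat[of 0 N n a] by (simp add: atLeast0LessThan)
    then show ?case by simp
  qed
  ultimately have "filterlim (\<lambda>n. sum a {N..<n}) at_top sequentially"
    by (rule filterlim_mono_eventually[OF _ order_refl order_refl])
  then have "filterlim (\<lambda>n. - sum a {N..<n}) at_bot sequentially"
    by (simp add: filterlim_uminus_at_bot)
  then have "(\<lambda>n. exp (- sum a {N..<n})) \<longlonglongrightarrow> 0"
    by (rule filterlim_compose[OF exp_at_bot])
  then have "(\<lambda>n. exp (- sum a {N..<n}) * s N) \<longlonglongrightarrow> 0 * s N"
    by (intro tendsto_mult tendsto_const)
  then have "\<forall>\<^sub>F n in sequentially. exp (- sum a {N..<n}) * s N < e"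
    using e by (intro order_tendstoD(2)) auto
  then obtain N3 where N3: "\<And>n. n \<ge> N3 \<Longrightarrow> exp (- sum a {N..<n}) * s N < e"
    by (auto simp: eventually_sequentially)
  show "\<exists>no. \<forall>n\<ge>no. norm (s n - 0) < r"
  proof (intro exI allI impI)
    fix n assume n: "n \<ge> max N N3"
    then obtain m where m: "n = N + m" using le_Suc_ex by (metis max.bounded_iff)
    have "exp (- sum a {N..<n}) * s N < e" using N3 n by simp
    moreover have "norm (sum c {N..<n}) < e" by (rule N2) (simp add: N_def)
    ultimately have "s n < e + e + e" using bound[of m] unfolding m real_norm_def by linarith
    then show "norm (s n - 0) < r" using s[of n] \<open>r > 0\<close> by (simp add: e_def)
  qed
qed

section \<open>The quadratic inequality along geodesics\<close>

context CAT0_space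
begin

lemma W_zero: "W x y 0 = x"
  using W1[of 0 x x y] by simp

lemma W_one: "W x y 1 = y"
  using W1[of 1 y x y] by simp

lemma dist_W_right: "l \<in> {0..1} \<Longrightarrow> dist (W x y l) y = (1 - l) * dist x y"
  using W2[of l 1 x y] by (auto simp: W_one)

lemma dist_W_left: "l \<in> {0..1} \<Longrightarrow> dist (W x y l) x = l * dist x y"
  using W2[of l 0 x y] by (auto simp: W_zero)

text \<open>The point \<open>W x y ((l + k) / 2)\<close> has distance \<open>dist a b / 2\<close> from both \<open>a = W x y l\<close> and
  \<open>b = W x y k\<close>, and the CN inequality admits only one such point.\<close>

lemma W_midpoint:
  assumes "l \<in> {0..1}" "k \<in> {0..1}"
  shows "W x y ((l + k) / 2) = W (W x y l) (W x y k) (1/2)"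
proof -
  let ?a = "W x y l" and ?b = "W x y k" and ?w = "W x y ((l + k) / 2)"
  have h: "(l + k) / 2 \<in> {0..1}" using assms by auto
  have d: "dist ?a ?b = \<bar>l - k\<bar> * dist x y" using W2 assms by blast
  have "dist ?w ?a = \<bar>(l + k) / 2 - l\<bar> * dist x y" using W2 h assms by blast
  also have "\<dots> = dist ?a ?b / 2" unfolding d by (simp add: abs_if field_simps)
  finally have wa: "dist ?w ?a = dist ?a ?b / 2" .
  have "dist ?w ?b = \<bar>(l + k) / 2 - k\<bar> * dist x y" using W2 h assms by blast
  also have "\<dots> = dist ?a ?b / 2" unfolding d by (simp add: abs_if field_simps)
  finally have wb: "dist ?w ?b = dist ?a ?b / 2" .
  have "(dist ?w (W ?a ?b (1/2)))\<^sup>2 \<le> 0"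
    using CN_minus[of ?w ?a ?b] unfolding wa wb by (simp add: power2_eq_square)
  then show ?thesis by simp
qed

lemma continuous_on_W: "continuous_on {0..1} (W x y)"
proof (rule lipschitz_on_continuous_on)
  show "(dist x y)-lipschitz_on {0..1} (W x y)"
    by (rule lipschitz_onI) (auto simp: W2 dist_real_def)
qed

text \<open>The difference \<open>g\<close> of the two sides is continuous and midpoint convex in \<open>l\<close>, and vanishes at the
  end points. A positive maximum, attained at \<open>t\<close>, would violate midpoint convexity on the largest
  interval in \<open>[0,1]\<close> centred at \<open>t\<close>, as \<open>g\<close> vanishes at one of its ends.\<close>

lemma CN_inequality:
  assumes l: "l \<in> {0..1}"
  shows "(dist z (W x y l))\<^sup>2
    \<le> (1 - l) * (dist z x)\<^sup>2 + l * (dist z y)\<^sup>2 - l * (1 - l) * (dist x y)\<^sup>2"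
proof -
  define g where "g t = (dist z (W x y t))\<^sup>2 - (1 - t) * (dist z x)\<^sup>2 - t * (dist z y)\<^sup>2
    + t * (1 - t) * (dist x y)\<^sup>2" for t
  have g01: "g 0 = 0" "g 1 = 0" by (simp_all add: g_def W_zero W_one)
  have cont: "continuous_on {0..1} g"
    unfolding g_def by (intro continuous_intros continuous_on_W)
  have mid: "g ((p + q) / 2) \<le> (g p + g q) / 2" if "p \<in> {0..1}" "q \<in> {0..1}" for p q
  proof -
    have "(dist (W x y p) (W x y q))\<^sup>2 = (p - q)\<^sup>2 * (dist x y)\<^sup>2"
      using W2[OF that] by (simp add: power_mult_distrib)
    then have "(dist z (W x y ((p + q) / 2)))\<^sup>2
      \<le> 1/2 * (dist z (W x y p))\<^sup>2 + 1/2 * (dist z (W x y q))\<^sup>2 - 1/4 * ((p - q)\<^sup>2 * (dist x y)\<^sup>2)"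
      using CN_minus[of z "W x y p" "W x y q"] W_midpoint[OF that, of x y] by simp
    then show ?thesis unfolding g_def by (simp add: field_simps power2_eq_square)
  qed
  obtain t where t: "t \<in> {0..1}" and max: "\<And>s. s \<in> {0..1} \<Longrightarrow> g s \<le> g t"
    using continuous_attains_sup[OF _ _ cont] by auto
  have "g t \<le> 0"
  proof (cases "t \<le> 1/2")
    case True
    then have "g t \<le> (g 0 + g (2 * t)) / 2" using mid[of 0 "2 * t"] t by simp
    moreover have "g (2 * t) \<le> g t" using max t True by simp
    ultimately show ?thesis using g01 by simp
  next
    case False
    then have "g t \<le> (g (2 * t - 1) + g 1) / 2" using mid[of "2 * t - 1" 1] t by simp
    moreover have "g (2 * t - 1) \<le> g t" using max t False by simp
    ultimately show ?thesis using g01 by simp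
  qed
  then have "g l \<le> 0" using max[OF l] by simp
  then show ?thesis by (simp add: g_def)
qed

text \<open>Both the end points and the parameter may vary; the recursions for the
  two kinds of step need this form to compare consecutive iterates.\<close>

lemma dist_W_W_le:
  assumes "l \<in> {0..1}" "k \<in> {0..1}"
  shows "dist (W x y l) (W x' y' k) \<le> (1 - l) * dist x x' + l * dist y y' + \<bar>l - k\<bar> * dist x' y'"
proof -
  have "dist (W x y l) (W x' y' k) \<le> dist (W x y l) (W x' y' l) + dist (W x' y' l) (W x' y' k)"
    by (rule dist_triangle)
  then show ?thesis using W4[OF assms(1), of x y x' y'] W2[OF assms, of x' y'] by linarith
qed

end

section \<open>Approximate fixed points and the projection\<close>

text \<open>For exact fixed points (\<open>e = 0\<close>) this is the convexity of the fixed point set. In general the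
  image of the midpoint is within \<open>e + dist x y / 2\<close> of both \<open>x\<close> and \<open>y\<close>, so
  that the CN inequality keeps it close to the midpoint.\<close>

lemma (in CAT0_space) dist_midpoint_image_le:
  assumes T: "nonexpansive_on C T" and C: "W_convex W C"
    and xy: "x \<in> C" "y \<in> C" "dist x (T x) \<le> e" "dist y (T y) \<le> e"
  shows "(dist (W x y (1/2)) (T (W x y (1/2))))\<^sup>2 \<le> e\<^sup>2 + e * dist x y"
proof -
  let ?m = "W x y (1/2)"
  have m: "?m \<in> C" using C xy by (auto simp: W_convex_def)
  have "dist (T ?m) x \<le> dist (T ?m) (T x) + dist x (T x)"
    by (metis dist_commute dist_triangle)
  also have "dist (T ?m) (T x) \<le> dist ?m x" using T m xy by (auto simp: nonexpansive_on_def)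
  finally have 1: "dist (T ?m) x \<le> e + dist x y / 2" using xy dist_W_left[of "1/2" x y] by simp
  have "dist (T ?m) y \<le> dist (T ?m) (T y) + dist y (T y)"
    by (metis dist_commute dist_triangle)
  also have "dist (T ?m) (T y) \<le> dist ?m y" using T m xy by (auto simp: nonexpansive_on_def)
  finally have 2: "dist (T ?m) y \<le> e + dist x y / 2" using xy dist_W_right[of "1/2" x y] by simp
  have "(dist (T ?m) ?m)\<^sup>2 \<le> (e + dist x y / 2)\<^sup>2 - 1/4 * (dist x y)\<^sup>2"
    using CN_minus[of "T ?m" x y] power_mono[OF 1, of 2] power_mono[OF 2, of 2] by simp
  then show ?thesis by (simp add: dist_commute power2_eq_square field_simps)
qed

definition approx_common_fix ::
    "'a::metric_space set \<Rightarrow> ('a \<Rightarrow> 'a) \<Rightarrow> ('a \<Rightarrow> 'a) \<Rightarrow> real \<Rightarrow> 'a set" where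
  "approx_common_fix C T U e = {x \<in> C. dist x (T x) \<le> e \<and> dist x (U x) \<le> e}"

lemma approx_common_fix_zero: "approx_common_fix C T U 0 = Fix_on C T \<inter> Fix_on C U"
proof -
  have "dist x (S x) \<le> 0 \<longleftrightarrow> S x = x" for x and S :: "'a \<Rightarrow> 'a"
    by (simp add: eq_commute)
  then show ?thesis unfolding approx_common_fix_def Fix_on_def by blast
qed

lemma approx_common_fix_mono: "e \<le> e' \<Longrightarrow> approx_common_fix C T U e \<subseteq> approx_common_fix C T U e'"
  by (auto simp: approx_common_fix_def)

lemma (in CAT0_space) midpoint_approx_common_fix:
  assumes "nonexpansive_on C T" "nonexpansive_on C U" "W_convex W C"
    and x: "x \<in> approx_common_fix C T U e" and y: "y \<in> approx_common_fix C T U e"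
    and e': "0 \<le> e'" "e\<^sup>2 + e * dist x y \<le> e'\<^sup>2"
  shows "W x y (1/2) \<in> approx_common_fix C T U e'"
proof -
  have xy: "x \<in> C" "y \<in> C" "dist x (T x) \<le> e" "dist y (T y) \<le> e"
    "dist x (U x) \<le> e" "dist y (U y) \<le> e"
    using x y by (auto simp: approx_common_fix_def)
  have "dist (W x y (1/2)) (S (W x y (1/2))) \<le> e'"
    if "nonexpansive_on C S" "dist x (S x) \<le> e" "dist y (S y) \<le> e" for S
  proof (rule power2_le_imp_le[OF _ e'(1)])
    show "(dist (W x y (1/2)) (S (W x y (1/2))))\<^sup>2 \<le> e'\<^sup>2"
      using dist_midpoint_image_le[OF that(1) assms(3) xy(1,2) that(2,3)] e'(2) by linarith
  qed
  note this[OF assms(1) xy(3,4)] this[OF assms(2) xy(5,6)]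
  moreover have "W x y (1/2) \<in> C" using assms(3) xy(1,2) by (simp add: W_convex_def)
  ultimately show ?thesis by (simp add: approx_common_fix_def)
qed

text \<open>The infimum \<open>r n\<close> of the distances from \<open>u\<close> to the \<open>1/(n+1)\<close>-approximate common
  fixed points increases to a limit \<open>R\<close>, which is at most the distance from \<open>u\<close>
  to any common fixed point. Points \<open>v n\<close> almost attaining \<open>r n\<close> form a Cauchy sequence:
  the midpoint of \<open>v m\<close> and \<open>v n\<close> is again an approximate fixed point, so its distance from \<open>u\<close> is
  at least almost \<open>R\<close>, and the CN inequality bounds \<open>dist (v m) (v n)\<close>. The limit is a
  common fixed point at distance at most \<open>R\<close>. The last conclusion expresses that the
  limit inferior of the distances from \<open>u\<close>, along points that are asymptotically fixed, is at least
  \<open>dist u p\<close>.\<close>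

lemma nearest_common_fixed_point:
  fixes W :: "'a::complete_space \<Rightarrow> 'a \<Rightarrow> real \<Rightarrow> 'a"
  assumes "CAT0_space W" and C: "W_convex W C" "closed C"
    and T: "nonexpansive_on C T" and U: "nonexpansive_on C U"
    and F: "Fix_on C T \<inter> Fix_on C U \<noteq> {}"
  obtains p where "p \<in> Fix_on C T \<inter> Fix_on C U"
    and "\<And>q. q \<in> Fix_on C T \<inter> Fix_on C U \<Longrightarrow> dist u p \<le> dist u q"
    and "\<And>e. e > 0 \<Longrightarrow> \<exists>d>0. \<forall>x\<in>approx_common_fix C T U d. dist u p - e \<le> dist u x"
proof -
  interpret CAT0_space W by fact
  define A where "A n = approx_common_fix C T U (inverse (real (Suc n)))" for n
  define r where "r n = (INF x\<in>A n. dist u x)" for n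
  obtain f where f: "f \<in> Fix_on C T \<inter> Fix_on C U" using F by auto
  have FA: "q \<in> A n" if "q \<in> Fix_on C T \<inter> Fix_on C U" for q n
    using that approx_common_fix_mono[of 0 "inverse (real (Suc n))" C T U]
    by (auto simp: A_def approx_common_fix_zero)
  have A_ne: "A n \<noteq> {}" for n using FA f by blast
  have A_anti: "A n \<subseteq> A m" if "m \<le> n" for m n
    unfolding A_def by (rule approx_common_fix_mono) (use that in \<open>simp add: field_simps\<close>)
  have bdd: "bdd_below (dist u ` A n)" for n
    by (rule bdd_belowI[of _ 0]) auto
  have r_le: "r n \<le> dist u x" if "x \<in> A n" for n x
    unfolding r_def by (rule cINF_lower[OF bdd that])
  have r_nonneg: "0 \<le> r n" for n
    unfolding r_def by (rule cINF_greatest[OF A_ne]) simp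
  have "incseq r"
    unfolding incseq_def r_def by (intro allI impI cINF_superset_mono A_ne bdd A_anti) auto
  then obtain R where R: "r \<longlonglongrightarrow> R" and r_le_R: "\<And>n. r n \<le> R"
    using incseq_convergent[of r "dist u f"] r_le FA f by metis
  have R_nonneg: "0 \<le> R" using r_nonneg[of 0] r_le_R[of 0] by linarith
  have R_le: "R \<le> dist u q" if "q \<in> Fix_on C T \<inter> Fix_on C U" for q
    by (rule LIMSEQ_le_const2[OF R]) (use r_le FA that in auto)
  have "\<exists>x\<in>A n. dist u x < r n + inverse (real (Suc n))" for n
    using cINF_less_iff[OF A_ne bdd, of n "r n + inverse (real (Suc n))"] by (simp add: r_def)
  then obtain v where vA: "\<And>n. v n \<in> A n"
      and v: "\<And>n. dist u (v n) < r n + inverse (real (Suc n))"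
    by metis
  have v_le: "dist u (v n) \<le> R + inverse (real (Suc N))" if "N \<le> n" for n N
  proof -
    have "inverse (real (Suc n)) \<le> inverse (real (Suc N))" using that by (simp add: field_simps)
    then show ?thesis using v[of n] r_le_R[of n] by linarith
  qed
  have inv: "(\<lambda>n. inverse (real (Suc n))) \<longlonglongrightarrow> 0" by (rule LIMSEQ_inverse_real_of_nat)
  define K where "K = 2 * (R + 1)"
  have v_K: "dist (v m) (v n) \<le> K" for m n
    using v_le[of 0 m] v_le[of 0 n] dist_triangle[of "v m" "v n" u]
    by (simp add: K_def dist_commute)
  have "Cauchy v"
  proof (rule metric_CauchyI)
    fix e :: real assume e: "e > 0"
    \<comment> \<open>The index \<open>k\<close> fixes how close to \<open>R\<close> the lower bound on distances has to be. Then \<open>N\<close>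
      is taken so large that midpoints of points of \<open>A N\<close> at distance at most \<open>K\<close> lie in \<open>A k\<close>.\<close>
    have "(\<lambda>n. (r n)\<^sup>2) \<longlonglongrightarrow> R\<^sup>2" by (intro tendsto_intros R)
    then have "\<forall>\<^sub>F n in sequentially. R\<^sup>2 - e\<^sup>2/8 < (r n)\<^sup>2"
      using e by (intro order_tendstoD(1)) auto
    then obtain k where k: "R\<^sup>2 - e\<^sup>2/8 < (r k)\<^sup>2"
      by (auto simp: eventually_sequentially)
    have "(\<lambda>n. (R + inverse (real (Suc n)))\<^sup>2) \<longlonglongrightarrow> (R + 0)\<^sup>2" by (intro tendsto_intros inv)
    then have "\<forall>\<^sub>F n in sequentially. (R + inverse (real (Suc n)))\<^sup>2 < R\<^sup>2 + e\<^sup>2/8"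
      using e by (intro order_tendstoD(2)) auto
    moreover have "(\<lambda>n. (inverse (real (Suc n)))\<^sup>2 + inverse (real (Suc n)) * K) \<longlonglongrightarrow> 0\<^sup>2 + 0 * K"
      by (intro tendsto_intros inv)
    then have "\<forall>\<^sub>F n in sequentially. (inverse (real (Suc n)))\<^sup>2 + inverse (real (Suc n)) * K
        < (inverse (real (Suc k)))\<^sup>2"
      by (intro order_tendstoD(2)) auto
    ultimately have ev: "\<forall>\<^sub>F n in sequentially. (R + inverse (real (Suc n)))\<^sup>2 < R\<^sup>2 + e\<^sup>2/8 \<and>
        (inverse (real (Suc n)))\<^sup>2 + inverse (real (Suc n)) * K < (inverse (real (Suc k)))\<^sup>2"
      by (rule eventually_conj)
    then obtain N where N1: "(R + inverse (real (Suc N)))\<^sup>2 < R\<^sup>2 + e\<^sup>2/8"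
      and N2: "(inverse (real (Suc N)))\<^sup>2 + inverse (real (Suc N)) * K < (inverse (real (Suc k)))\<^sup>2"
      using eventually_happens'[OF sequentially_bot ev] by blast
    show "\<exists>M. \<forall>m\<ge>M. \<forall>n\<ge>M. dist (v m) (v n) < e"
    proof (intro exI allI impI)
      fix m n assume mn: "m \<ge> N" "n \<ge> N"
      let ?w = "W (v m) (v n) (1/2)"
      have vN: "v m \<in> A N" "v n \<in> A N" using vA A_anti mn by blast+
      have "inverse (real (Suc N)) * dist (v m) (v n) \<le> inverse (real (Suc N)) * K"
        by (intro mult_left_mono v_K) simp
      then have "?w \<in> A k"
        unfolding A_def using N2 vN
        by (intro midpoint_approx_common_fix[OF T U C(1), of _ "inverse (real (Suc N))"])
          (linarith | simp add: A_def)+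
      then have "(r k)\<^sup>2 \<le> (dist u ?w)\<^sup>2" using r_le r_nonneg power_mono by blast
      moreover have "(dist u (v m))\<^sup>2 \<le> (R + inverse (real (Suc N)))\<^sup>2"
        "(dist u (v n))\<^sup>2 \<le> (R + inverse (real (Suc N)))\<^sup>2"
        using v_le mn by (intro power_mono; simp)+
      ultimately have "(dist (v m) (v n))\<^sup>2 < e\<^sup>2"
        using CN_minus[of u "v m" "v n"] k N1 by linarith
      then show "dist (v m) (v n) < e" using e power2_less_imp_less by fastforce
    qed
  qed
  then obtain p where p: "v \<longlonglongrightarrow> p" using Cauchy_convergent convergent_def by blast
  have pC: "p \<in> C"
    using closed_sequentially[OF C(2) _ p] vA by (auto simp: A_def approx_common_fix_def)
  have fixed: "S p = p" if S: "nonexpansive_on C S"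
    and vS: "\<And>n. dist (v n) (S (v n)) \<le> inverse (real (Suc n))" for S
  proof -
    have "dist p (S p) \<le> 2 * dist (v n) p + inverse (real (Suc n))" for n
    proof -
      have "dist (S (v n)) (S p) \<le> dist (v n) p"
        using S pC vA by (auto simp: nonexpansive_on_def A_def approx_common_fix_def)
      then show ?thesis
        using vS[of n] dist_triangle[of p "S p" "v n"] dist_triangle[of "v n" "S p" "S (v n)"]
        by (simp add: dist_commute)
    qed
    moreover have "(\<lambda>n. 2 * dist (v n) p + inverse (real (Suc n))) \<longlonglongrightarrow> 2 * dist p p + 0"
      by (intro tendsto_intros p inv)
    ultimately have "dist p (S p) \<le> 2 * dist p p + 0"
      by (intro LIMSEQ_le_const) auto
    then show ?thesis by simp
  qed
  have pF: "p \<in> Fix_on C T \<inter> Fix_on C U"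
    using pC fixed[OF T] fixed[OF U] vA by (auto simp: Fix_on_def A_def approx_common_fix_def)
  have "(\<lambda>n. dist u (v n)) \<longlonglongrightarrow> dist u p" by (intro tendsto_intros p)
  moreover have "(\<lambda>n. R + inverse (real (Suc n))) \<longlonglongrightarrow> R + 0" by (intro tendsto_intros inv)
  ultimately have pR: "dist u p \<le> R + 0"
    by (rule LIMSEQ_le) (use v_le in auto)
  show ?thesis
  proof (rule that[OF pF])
    show "dist u p \<le> dist u q" if "q \<in> Fix_on C T \<inter> Fix_on C U" for q
      using pR R_le[OF that] by linarith
    show "\<exists>d>0. \<forall>x\<in>approx_common_fix C T U d. dist u p - e \<le> dist u x" if "e > 0" for e
    proof -
      have "\<forall>\<^sub>F n in sequentially. R - e < r n" using R that by (intro order_tendstoD(1)) auto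
      then obtain n where n: "R - e < r n" by (auto simp: eventually_sequentially)
      have "\<forall>x\<in>A n. dist u p - e \<le> dist u x" using r_le[of _ n] n pR by fastforce
      then show ?thesis unfolding A_def by (intro exI[of _ "inverse (real (Suc n))"]) auto
    qed
  qed
qed

text \<open>Two nearest common fixed points would have a common fixed point nearer to \<open>u\<close> as
  their midpoint.\<close>

lemma (in CAT0_space) metric_projection_common_fix_eqI:
  assumes "nonexpansive_on C T" "nonexpansive_on C U" "W_convex W C"
    and p: "p \<in> Fix_on C T \<inter> Fix_on C U"
    and min: "\<And>q. q \<in> Fix_on C T \<inter> Fix_on C U \<Longrightarrow> dist u p \<le> dist u q"
  shows "metric_projection (Fix_on C T \<inter> Fix_on C U) u = p"
  unfolding metric_projection_def
proof (rule the_equality)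
  fix q assume q: "q \<in> Fix_on C T \<inter> Fix_on C U \<and> (\<forall>x\<in>Fix_on C T \<inter> Fix_on C U. dist u q \<le> dist u x)"
  have "W p q (1/2) \<in> Fix_on C T \<inter> Fix_on C U"
    using midpoint_approx_common_fix[OF assms(1-3), of p 0 q 0] p q
    by (simp add: approx_common_fix_zero)
  then have "(dist u p)\<^sup>2 \<le> (dist u (W p q (1/2)))\<^sup>2" by (intro power_mono min) auto
  moreover have eq: "dist u q = dist u p" using min[of q] q p by (intro antisym) auto
  ultimately have "(dist p q)\<^sup>2 \<le> 0" using CN_minus[of u p q, unfolded eq] by linarith
  then show "q = p" by simp
qed (use p min in auto)

section \<open>The iteration\<close>

text \<open>The even iterates \<open>z\<close> come from a relaxed step with \<open>U\<close>, the odd iterates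
  \<open>y\<close> from a step with \<open>T\<close> pulled towards the anchor \<open>u\<close>. The bound \<open>b\<close> is what the
  conditions on the limits inferior and superior of \<open>\<beta>\<close> amount to.\<close>

locale alternating_iteration = CAT0_space W
  for W :: "'a::metric_space \<Rightarrow> 'a \<Rightarrow> real \<Rightarrow> 'a" +
  fixes C :: "'a set" and T U :: "'a \<Rightarrow> 'a" and u :: 'a
    and \<alpha> \<beta> :: "nat \<Rightarrow> real" and z y :: "nat \<Rightarrow> 'a" and b :: real
  assumes C: "W_convex W C" and T: "nonexpansive_on C T" and U: "nonexpansive_on C U"
    and F_nonempty: "Fix_on C T \<inter> Fix_on C U \<noteq> {}"
    and u: "u \<in> C" and z_0: "z 0 \<in> C"
    and \<alpha>: "\<And>n. \<alpha> n \<in> {0..1}" and \<beta>: "\<And>n. \<beta> n \<in> {0..1}"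
    and \<alpha>_lim: "\<alpha> \<longlonglongrightarrow> 0"
    and \<alpha>_sum: "filterlim (\<lambda>N. \<Sum>n<N. \<alpha> n) at_top sequentially"
    and \<alpha>_var: "summable (\<lambda>n. \<bar>\<alpha> (Suc n) - \<alpha> n\<bar>)"
    and \<beta>_var: "summable (\<lambda>n. \<bar>\<beta> (Suc n) - \<beta> n\<bar>)"
    and b: "0 < b" "\<forall>\<^sub>F n in sequentially. b \<le> \<beta> n * (1 - \<beta> n)"
    and y: "\<And>n. y n = W (T (z n)) u (\<alpha> n)"
    and z: "\<And>n. z (Suc n) = W (U (y n)) (y n) (\<beta> n)"
begin

lemma T_in: "x \<in> C \<Longrightarrow> T x \<in> C" and U_in: "x \<in> C \<Longrightarrow> U x \<in> C"
  using T U by (auto simp: nonexpansive_on_def)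

lemma T_le: "x \<in> C \<Longrightarrow> x' \<in> C \<Longrightarrow> dist (T x) (T x') \<le> dist x x'"
  and U_le: "x \<in> C \<Longrightarrow> x' \<in> C \<Longrightarrow> dist (U x) (U x') \<le> dist x x'"
  using T U by (auto simp: nonexpansive_on_def)

lemma T_fix_le: "q \<in> Fix_on C T \<inter> Fix_on C U \<Longrightarrow> x \<in> C \<Longrightarrow> dist q (T x) \<le> dist q x"
  using T_le[of q x] by (simp add: Fix_on_def)

lemma U_fix_le: "q \<in> Fix_on C T \<inter> Fix_on C U \<Longrightarrow> x \<in> C \<Longrightarrow> dist q (U x) \<le> dist q x"
  using U_le[of q x] by (simp add: Fix_on_def)

lemma W_in: "x \<in> C \<Longrightarrow> x' \<in> C \<Longrightarrow> l \<in> {0..1} \<Longrightarrow> W x x' l \<in> C"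
  using C by (simp add: W_convex_def)

lemma y_in_if: "z n \<in> C \<Longrightarrow> y n \<in> C"
  unfolding y by (intro W_in T_in u \<alpha>)

lemma z_in: "z n \<in> C"
proof (induction n)
  case (Suc n)
  then show ?case unfolding z by (intro W_in U_in y_in_if \<beta>)
qed (rule z_0)

lemma y_in: "y n \<in> C"
  by (rule y_in_if[OF z_in])

lemma iterates_bounded:
  assumes q: "q \<in> Fix_on C T \<inter> Fix_on C U"
  obtains M where "0 \<le> M" "dist q u \<le> M" "\<And>n. dist q (z n) \<le> M" "\<And>n. dist q (y n) \<le> M"
proof -
  define M where "M = max (dist q u) (dist q (z 0))"
  have yM: "dist q (y n) \<le> M" if "dist q (z n) \<le> M" for n
  proof -
    have "dist q (y n) \<le> (1 - \<alpha> n) * dist q (T (z n)) + \<alpha> n * dist q u"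
      unfolding y by (rule W1[OF \<alpha>])
    also have "\<dots> \<le> (1 - \<alpha> n) * M + \<alpha> n * M"
      using \<alpha>[of n] that T_fix_le[OF q z_in, of n]
      by (intro add_mono mult_left_mono) (auto simp: M_def)
    finally show ?thesis by (simp add: algebra_simps)
  qed
  have zM: "dist q (z n) \<le> M" for n
  proof (induction n)
    case (Suc n)
    have "dist q (z (Suc n)) \<le> (1 - \<beta> n) * dist q (U (y n)) + \<beta> n * dist q (y n)"
      unfolding z by (rule W1[OF \<beta>])
    also have "\<dots> \<le> (1 - \<beta> n) * M + \<beta> n * M"
      using \<beta>[of n] yM[OF Suc] U_fix_le[OF q y_in, of n]
      by (intro add_mono mult_left_mono) auto
    finally show ?case by (simp add: algebra_simps)
  qed (simp add: M_def)
  have "dist q u \<le> M" by (simp add: M_def)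
  moreover have "0 \<le> M" using calculation zero_le_dist[of q u] by linarith
  ultimately show ?thesis using that zM yM by blast
qed

text \<open>Each step is nonexpansive up to the variation of its parameter, and the
  step with \<open>T\<close> contracts by the factor \<open>1 - \<alpha> (n+1)\<close>.\<close>

lemma z_steps_tendsto_zero: "(\<lambda>n. dist (z (Suc n)) (z n)) \<longlonglongrightarrow> 0"
proof -
  obtain q where q: "q \<in> Fix_on C T \<inter> Fix_on C U" using F_nonempty by blast
  obtain M where M: "0 \<le> M" "dist q u \<le> M" "\<And>n. dist q (z n) \<le> M" "\<And>n. dist q (y n) \<le> M"
    using iterates_bounded[OF q] by blast
  have y_step: "dist (y (Suc n)) (y n)
      \<le> (1 - \<alpha> (Suc n)) * dist (z (Suc n)) (z n) + \<bar>\<alpha> (Suc n) - \<alpha> n\<bar> * (2 * M)" for n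
  proof -
    have "dist (y (Suc n)) (y n) \<le> (1 - \<alpha> (Suc n)) * dist (T (z (Suc n))) (T (z n))
        + \<alpha> (Suc n) * dist u u + \<bar>\<alpha> (Suc n) - \<alpha> n\<bar> * dist (T (z n)) u"
      unfolding y by (rule dist_W_W_le[OF \<alpha> \<alpha>])
    also have "\<dots> \<le> (1 - \<alpha> (Suc n)) * dist (z (Suc n)) (z n)
        + \<alpha> (Suc n) * 0 + \<bar>\<alpha> (Suc n) - \<alpha> n\<bar> * (2 * M)"
      using \<alpha>[of "Suc n"] T_le[OF z_in z_in] T_fix_le[OF q z_in, of n] M(2) M(3)[of n]
        dist_triangle3[of "T (z n)" u q]
      by (intro add_mono mult_left_mono) auto
    finally show ?thesis by simp
  qed
  have z_step: "dist (z (Suc (Suc n))) (z (Suc n))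
      \<le> dist (y (Suc n)) (y n) + \<bar>\<beta> (Suc n) - \<beta> n\<bar> * (2 * M)" for n
  proof -
    have "dist (z (Suc (Suc n))) (z (Suc n)) \<le> (1 - \<beta> (Suc n)) * dist (U (y (Suc n))) (U (y n))
        + \<beta> (Suc n) * dist (y (Suc n)) (y n) + \<bar>\<beta> (Suc n) - \<beta> n\<bar> * dist (U (y n)) (y n)"
      unfolding z by (rule dist_W_W_le[OF \<beta> \<beta>])
    also have "\<dots> \<le> (1 - \<beta> (Suc n)) * dist (y (Suc n)) (y n)
        + \<beta> (Suc n) * dist (y (Suc n)) (y n) + \<bar>\<beta> (Suc n) - \<beta> n\<bar> * (2 * M)"
      using \<beta>[of "Suc n"] U_le[OF y_in y_in] U_fix_le[OF q y_in, of n] M(4)[of n]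
        dist_triangle3[of "U (y n)" "y n" q]
      by (intro add_mono mult_left_mono) auto
    finally show ?thesis by (simp add: algebra_simps)
  qed
  show ?thesis
  proof (rule averaged_recursion_tendsto_zero)
    show "\<alpha> (Suc n) \<in> {0..1}" for n by (rule \<alpha>)
    show "filterlim (\<lambda>N. \<Sum>n<N. \<alpha> (Suc n)) at_top sequentially"
    proof -
      have "filterlim (\<lambda>N. - \<alpha> 0 + (\<Sum>n<Suc N. \<alpha> n)) at_top sequentially"
        by (intro filterlim_tendsto_add_at_top[OF tendsto_const]
            filterlim_compose[OF \<alpha>_sum filterlim_Suc])
      then show ?thesis by (simp only: sum.lessThan_Suc_shift) simp
    qed
    show "\<forall>\<^sub>F n in sequentially. 0 \<le> e" if "e > 0" for e :: real using that by simp
    show "summable (\<lambda>n. \<bar>\<alpha> (Suc n) - \<alpha> n\<bar> * (2 * M) + \<bar>\<beta> (Suc n) - \<beta> n\<bar> * (2 * M))"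
      by (intro summable_add summable_mult2 \<alpha>_var \<beta>_var)
    show "0 \<le> \<bar>\<alpha> (Suc n) - \<alpha> n\<bar> * (2 * M) + \<bar>\<beta> (Suc n) - \<beta> n\<bar> * (2 * M)" for n
      using M(1) by simp
    show "dist (z (Suc (Suc n))) (z (Suc n)) \<le> (1 - \<alpha> (Suc n)) * dist (z (Suc n)) (z n)
        + \<alpha> (Suc n) * 0 + (\<bar>\<alpha> (Suc n) - \<alpha> n\<bar> * (2 * M) + \<bar>\<beta> (Suc n) - \<beta> n\<bar> * (2 * M))" for n
      using y_step[of n] z_step[of n] by simp
  qed simp
qed

text \<open>This inequality serves twice: its term with \<open>\<beta>\<close> controls the displacement under
  \<open>U\<close>, and without that term it is the recursion that yields convergence.\<close>

lemma quadratic_step: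
  assumes q: "q \<in> Fix_on C T \<inter> Fix_on C U"
  shows "(dist q (z (Suc n)))\<^sup>2 + \<beta> n * (1 - \<beta> n) * (dist (U (y n)) (y n))\<^sup>2
    \<le> (1 - \<alpha> n) * (dist q (z n))\<^sup>2
      + \<alpha> n * ((dist q u)\<^sup>2 - (1 - \<alpha> n) * (dist (T (z n)) u)\<^sup>2)"
proof -
  have "(dist q (z (Suc n)))\<^sup>2 + \<beta> n * (1 - \<beta> n) * (dist (U (y n)) (y n))\<^sup>2
      \<le> (1 - \<beta> n) * (dist q (U (y n)))\<^sup>2 + \<beta> n * (dist q (y n))\<^sup>2"
    using CN_inequality[OF \<beta>[of n], of q "U (y n)" "y n"] unfolding z by simp
  also have "\<dots> \<le> (1 - \<beta> n) * (dist q (y n))\<^sup>2 + \<beta> n * (dist q (y n))\<^sup>2"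
    using \<beta>[of n] U_fix_le[OF q y_in, of n] by (intro add_mono mult_left_mono power_mono) auto
  also have "\<dots> = (dist q (y n))\<^sup>2" by (simp add: algebra_simps)
  also have "\<dots> \<le> (1 - \<alpha> n) * (dist q (T (z n)))\<^sup>2 + \<alpha> n * (dist q u)\<^sup>2
      - \<alpha> n * (1 - \<alpha> n) * (dist (T (z n)) u)\<^sup>2"
    unfolding y by (rule CN_inequality[OF \<alpha>])
  also have "\<dots> \<le> (1 - \<alpha> n) * (dist q (z n))\<^sup>2 + \<alpha> n * (dist q u)\<^sup>2
      - \<alpha> n * (1 - \<alpha> n) * (dist (T (z n)) u)\<^sup>2"
    using \<alpha>[of n] T_fix_le[OF q z_in, of n]
    by (intro diff_right_mono add_mono mult_left_mono power_mono) auto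
  finally show ?thesis by (simp add: algebra_simps)
qed

lemma U_displacement_tendsto_zero: "(\<lambda>n. dist (U (y n)) (y n)) \<longlonglongrightarrow> 0"
proof -
  obtain q where q: "q \<in> Fix_on C T \<inter> Fix_on C U" using F_nonempty by blast
  obtain M where M: "0 \<le> M" "dist q u \<le> M" "\<And>n. dist q (z n) \<le> M" "\<And>n. dist q (y n) \<le> M"
    using iterates_bounded[OF q] by blast
  let ?d = "\<lambda>n. dist (z (Suc n)) (z n)"
  have bound: "\<beta> n * (1 - \<beta> n) * (dist (U (y n)) (y n))\<^sup>2 \<le> ?d n * (2 * M) + \<alpha> n * M\<^sup>2" for n
  proof -
    have "(dist q (z n))\<^sup>2 - (dist q (z (Suc n)))\<^sup>2
        = (dist q (z n) - dist q (z (Suc n))) * (dist q (z n) + dist q (z (Suc n)))"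
      by (simp add: power2_eq_square algebra_simps)
    also have "\<dots> \<le> ?d n * (2 * M)"
    proof (rule mult_mono)
      show "dist q (z n) - dist q (z (Suc n)) \<le> ?d n"
        using dist_triangle[of q "z n" "z (Suc n)"] by simp
      show "dist q (z n) + dist q (z (Suc n)) \<le> 2 * M" using M(3)[of n] M(3)[of "Suc n"] by simp
    qed auto
    finally have 1: "(dist q (z n))\<^sup>2 - (dist q (z (Suc n)))\<^sup>2 \<le> ?d n * (2 * M)" .
    have "\<alpha> n * ((dist q u)\<^sup>2 - (1 - \<alpha> n) * (dist (T (z n)) u)\<^sup>2) \<le> \<alpha> n * (M\<^sup>2 - 0)"
      using \<alpha>[of n] M(2) by (intro mult_left_mono diff_mono power_mono) auto
    moreover have "(1 - \<alpha> n) * (dist q (z n))\<^sup>2 \<le> 1 * (dist q (z n))\<^sup>2"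
      using \<alpha>[of n] by (intro mult_right_mono) auto
    ultimately show ?thesis using quadratic_step[OF q, of n] 1 by simp
  qed
  have "(\<lambda>n. (?d n * (2 * M) + \<alpha> n * M\<^sup>2) / b) \<longlonglongrightarrow> (0 * (2 * M) + 0 * M\<^sup>2) / b"
    using b(1) by (intro tendsto_intros z_steps_tendsto_zero \<alpha>_lim) auto
  then have lim: "(\<lambda>n. (?d n * (2 * M) + \<alpha> n * M\<^sup>2) / b) \<longlonglongrightarrow> 0" by simp
  have "\<forall>\<^sub>F n in sequentially. (dist (U (y n)) (y n))\<^sup>2 \<le> (?d n * (2 * M) + \<alpha> n * M\<^sup>2) / b"
    using b(2)
  proof eventually_elim
    case (elim n)
    have "b * (dist (U (y n)) (y n))\<^sup>2 \<le> \<beta> n * (1 - \<beta> n) * (dist (U (y n)) (y n))\<^sup>2"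
      using elim by (intro mult_right_mono) auto
    then show ?case using bound[of n] b(1) by (simp add: field_simps)
  qed
  then have "(\<lambda>n. (dist (U (y n)) (y n))\<^sup>2) \<longlonglongrightarrow> 0"
    by (intro tendsto_sandwich[OF _ _ tendsto_const lim]) auto
  then have "(\<lambda>n. sqrt ((dist (U (y n)) (y n))\<^sup>2)) \<longlonglongrightarrow> sqrt 0" by (rule tendsto_real_sqrt)
  then show ?thesis by simp
qed

lemma dist_z_y_tendsto_zero: "(\<lambda>n. dist (z n) (y n)) \<longlonglongrightarrow> 0"
proof (rule tendsto_sandwich[OF _ _ tendsto_const])
  have "dist (z n) (y n) \<le> dist (z (Suc n)) (z n) + dist (U (y n)) (y n)" for n
  proof -
    have "dist (z (Suc n)) (y n) = (1 - \<beta> n) * dist (U (y n)) (y n)"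
      unfolding z by (rule dist_W_right[OF \<beta>])
    also have "\<dots> \<le> 1 * dist (U (y n)) (y n)" using \<beta>[of n] by (intro mult_right_mono) auto
    finally show ?thesis using dist_triangle3[of "z n" "y n" "z (Suc n)"] by simp
  qed
  then show "\<forall>\<^sub>F n in sequentially. dist (z n) (y n)
      \<le> dist (z (Suc n)) (z n) + dist (U (y n)) (y n)" by simp
  show "(\<lambda>n. dist (z (Suc n)) (z n) + dist (U (y n)) (y n)) \<longlonglongrightarrow> 0"
    using tendsto_add[OF z_steps_tendsto_zero U_displacement_tendsto_zero] by simp
qed simp

lemma dist_z_Tz_tendsto_zero: "(\<lambda>n. dist (z n) (T (z n))) \<longlonglongrightarrow> 0"
proof -
  obtain q where q: "q \<in> Fix_on C T \<inter> Fix_on C U" using F_nonempty by blast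
  obtain M where M: "0 \<le> M" "dist q u \<le> M" "\<And>n. dist q (z n) \<le> M" "\<And>n. dist q (y n) \<le> M"
    using iterates_bounded[OF q] by blast
  have "dist (z n) (T (z n)) \<le> dist (z n) (y n) + \<alpha> n * (2 * M)" for n
  proof -
    have "dist (y n) (T (z n)) = \<alpha> n * dist (T (z n)) u"
      unfolding y by (rule dist_W_left[OF \<alpha>])
    also have "\<dots> \<le> \<alpha> n * (2 * M)"
      using \<alpha>[of n] T_fix_le[OF q z_in, of n] M(2) M(3)[of n] dist_triangle3[of "T (z n)" u q]
      by (intro mult_left_mono) auto
    finally show ?thesis using dist_triangle[of "z n" "T (z n)" "y n"] by simp
  qed
  then have "\<forall>\<^sub>F n in sequentially. dist (z n) (T (z n)) \<le> dist (z n) (y n) + \<alpha> n * (2 * M)"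
    by (rule always_eventually[OF allI])
  moreover have "(\<lambda>n. dist (z n) (y n) + \<alpha> n * (2 * M)) \<longlonglongrightarrow> 0 + 0 * (2 * M)"
    by (intro tendsto_intros dist_z_y_tendsto_zero \<alpha>_lim)
  then have "(\<lambda>n. dist (z n) (y n) + \<alpha> n * (2 * M)) \<longlonglongrightarrow> 0" by simp
  ultimately show ?thesis
    by (rule tendsto_sandwich[OF always_eventually[OF allI[OF zero_le_dist]] _ tendsto_const])
qed

lemma z_eventually_approx_common_fix:
  assumes "e > 0"
  shows "\<forall>\<^sub>F n in sequentially. z n \<in> approx_common_fix C T U e"
proof -
  have "(\<lambda>n. 2 * dist (z n) (y n) + dist (U (y n)) (y n)) \<longlonglongrightarrow> 2 * 0 + 0"
    by (intro tendsto_intros dist_z_y_tendsto_zero U_displacement_tendsto_zero)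
  then have "\<forall>\<^sub>F n in sequentially. 2 * dist (z n) (y n) + dist (U (y n)) (y n) < e"
    using assms by (intro order_tendstoD(2)) auto
  moreover have "\<forall>\<^sub>F n in sequentially. dist (z n) (T (z n)) < e"
    using assms dist_z_Tz_tendsto_zero by (intro order_tendstoD(2)) auto
  ultimately show ?thesis
  proof eventually_elim
    case (elim n)
    have "dist (z n) (U (z n)) \<le> dist (z n) (y n) + dist (y n) (U (y n)) + dist (U (y n)) (U (z n))"
      using dist_triangle[of "z n" "U (z n)" "y n"] dist_triangle[of "y n" "U (z n)" "U (y n)"]
      by simp
    then show ?case
      using elim z_in U_le[OF y_in z_in, of n n] by (simp add: approx_common_fix_def dist_commute)
  qed
qed

text \<open>As the even iterates are asymptotically fixed by both maps, the assumption \<open>far\<close> makes the coefficient of \<open>\<alpha> n\<close> in \<open>quadratic_step\<close>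
  asymptotically nonpositive.\<close>

lemma z_tendsto_nearest:
  assumes p: "p \<in> Fix_on C T \<inter> Fix_on C U"
    and far: "\<And>e. e > 0 \<Longrightarrow> \<exists>d>0. \<forall>x\<in>approx_common_fix C T U d. dist u p - e \<le> dist u x"
  shows "z \<longlonglongrightarrow> p"
proof -
  obtain M where M: "0 \<le> M" "dist p u \<le> M" "\<And>n. dist p (z n) \<le> M" "\<And>n. dist p (y n) \<le> M"
    using iterates_bounded[OF p] by blast
  let ?t = "\<lambda>n. dist (T (z n)) u"
  have t_le: "?t n \<le> 2 * M" for n
    using T_fix_le[OF p z_in, of n] M(2) M(3)[of n] dist_triangle3[of "T (z n)" u p] by simp
  have neg: "\<forall>\<^sub>F n in sequentially. (dist p u)\<^sup>2 - (1 - \<alpha> n) * (?t n)\<^sup>2 \<le> e" if e: "e > 0" for e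
  proof -
    \<comment> \<open>A positive difference of the squares of \<open>dist p u\<close> and \<open>?t n\<close> is at most \<open>h * (2 * M)\<close>, since
      then both distances are at most \<open>M\<close>; the other half of \<open>e\<close> absorbs \<open>\<alpha> n * (?t n)\<^sup>2\<close>.\<close>
    define h where "h = e / (4 * (M + 1))"
    have h: "h > 0" using e M(1) by (simp add: h_def)
    have hM: "h * (2 * M) \<le> e / 2" using e M(1) by (simp add: h_def field_simps)
    obtain d where d: "d > 0" "\<And>x. x \<in> approx_common_fix C T U d \<Longrightarrow> dist u p - h/2 \<le> dist u x"
      using far[of "h/2"] h by auto
    have "(\<lambda>n. \<alpha> n * (2 * M)\<^sup>2) \<longlonglongrightarrow> 0 * (2 * M)\<^sup>2" by (intro tendsto_intros \<alpha>_lim)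
    then have "\<forall>\<^sub>F n in sequentially. \<alpha> n * (2 * M)\<^sup>2 < e / 2"
      using e by (intro order_tendstoD(2)) auto
    moreover have "\<forall>\<^sub>F n in sequentially. dist (z n) (T (z n)) < h / 2"
      using h dist_z_Tz_tendsto_zero by (intro order_tendstoD(2)) auto
    moreover have "\<forall>\<^sub>F n in sequentially. z n \<in> approx_common_fix C T U d"
      by (rule z_eventually_approx_common_fix[OF d(1)])
    ultimately show ?thesis
    proof eventually_elim
      case (elim n)
      have close: "dist p u - ?t n \<le> h"
        using d(2)[OF elim(3)] elim(2) dist_triangle[of u "z n" "T (z n)"]
        by (simp add: dist_commute)
      have "(dist p u)\<^sup>2 - (?t n)\<^sup>2 \<le> h * (2 * M)"
      proof (cases "dist p u \<le> ?t n")
        case True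
        then have "(dist p u)\<^sup>2 \<le> (?t n)\<^sup>2" by (intro power_mono) auto
        moreover have "0 \<le> h * (2 * M)" using h M(1) by simp
        ultimately show ?thesis by linarith
      next
        case False
        have "(dist p u)\<^sup>2 - (?t n)\<^sup>2 = (dist p u - ?t n) * (dist p u + ?t n)"
          by (simp add: power2_eq_square algebra_simps)
        also have "\<dots> \<le> h * (2 * M)" using False close h M(2) by (intro mult_mono) auto
        finally show ?thesis .
      qed
      moreover have "\<alpha> n * (?t n)\<^sup>2 \<le> \<alpha> n * (2 * M)\<^sup>2"
        using \<alpha>[of n] t_le by (intro mult_left_mono power_mono) auto
      ultimately show ?case using hM elim(1) by (simp add: algebra_simps)
    qed
  qed
  have "(\<lambda>n. (dist p (z n))\<^sup>2) \<longlonglongrightarrow> 0"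
  proof (rule averaged_recursion_tendsto_zero[OF _ \<alpha> \<alpha>_sum neg])
    show "(dist p (z (Suc n)))\<^sup>2 \<le> (1 - \<alpha> n) * (dist p (z n))\<^sup>2
        + \<alpha> n * ((dist p u)\<^sup>2 - (1 - \<alpha> n) * (?t n)\<^sup>2) + 0" for n
    proof -
      have "0 \<le> \<beta> n * (1 - \<beta> n) * (dist (U (y n)) (y n))\<^sup>2" using \<beta>[of n] by simp
      then show ?thesis using quadratic_step[OF p, of n] by linarith
    qed
  qed auto
  then have "(\<lambda>n. sqrt ((dist p (z n))\<^sup>2)) \<longlonglongrightarrow> sqrt 0" by (rule tendsto_real_sqrt)
  then have "(\<lambda>n. dist (z n) p) \<longlonglongrightarrow> 0" by (simp add: dist_commute)
  then show ?thesis by (rule iffD2[OF tendsto_dist_iff])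
qed

end

lemma eventually_bounded_away_from_ends:
  fixes \<beta> :: "nat \<Rightarrow> real"
  assumes "0 < liminf (\<lambda>n. ereal (\<beta> n))" "limsup (\<lambda>n. ereal (\<beta> n)) < 1"
  obtains b where "0 < b" "\<forall>\<^sub>F n in sequentially. b \<le> \<beta> n * (1 - \<beta> n)"
proof -
  obtain l where l: "0 < ereal l" "ereal l < liminf (\<lambda>n. ereal (\<beta> n))"
    using ereal_dense2[OF assms(1)] by blast
  obtain k where k: "limsup (\<lambda>n. ereal (\<beta> n)) < ereal k" "ereal k < 1"
    using ereal_dense2[OF assms(2)] by blast
  have lk: "0 < l" "k < 1" using l(1) k(2) by auto
  have "\<forall>\<^sub>F n in sequentially. l * (1 - k) \<le> \<beta> n * (1 - \<beta> n)"
    using less_LiminfD[OF l(2)] Limsup_lessD[OF k(1)]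
  proof eventually_elim
    case (elim n)
    then show ?case using lk by (intro mult_mono) auto
  qed
  moreover have "0 < l * (1 - k)" using lk by simp
  ultimately show ?thesis using that by blast
qed

section \<open>Strong convergence\<close>

theorem theorem1p1:
  fixes W :: "'a::complete_space \<Rightarrow> 'a \<Rightarrow> real \<Rightarrow> 'a"
    and C :: "'a set"
    and T U :: "'a \<Rightarrow> 'a"
    and u x0 :: 'a
    and \<alpha> \<beta> :: "nat \<Rightarrow> real"
    and x :: "nat \<Rightarrow> 'a"
  assumes "CAT0_space W"
    and "C \<noteq> {}" and "W_convex W C" and "closed C"
    and "nonexpansive_on C T" and "nonexpansive_on C U"
    and "Fix_on C T \<inter> Fix_on C U \<noteq> {}"
    and "u \<in> C" and "x0 \<in> C"
    and "\<And>n. \<alpha> n \<in> {0..1}" and "\<And>n. \<beta> n \<in> {0<..<1}"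
    and "\<alpha> \<longlonglongrightarrow> 0"
    and "filterlim (\<lambda>N. \<Sum>n<N. \<alpha> n) at_top sequentially"
    and "summable (\<lambda>n. \<bar>\<alpha> (n + 1) - \<alpha> n\<bar>)"
    and "summable (\<lambda>n. \<bar>\<beta> (n + 1) - \<beta> n\<bar>)"
    and "0 < liminf (\<lambda>n. ereal (\<beta> n))"
    and "liminf (\<lambda>n. ereal (\<beta> n)) \<le> limsup (\<lambda>n. ereal (\<beta> n))"
    and "limsup (\<lambda>n. ereal (\<beta> n)) < 1"
    and "x 0 = x0"
    and "\<And>n. x (2 * n + 1) = W (T (x (2 * n))) u (\<alpha> n)"
    and "\<And>n. x (2 * n + 2) = W (U (x (2 * n + 1))) (x (2 * n + 1)) (\<beta> n)"
  shows "x \<longlonglongrightarrow> metric_projection (Fix_on C T \<inter> Fix_on C U) u"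
proof -
  obtain b where b: "0 < b" "\<forall>\<^sub>F n in sequentially. b \<le> \<beta> n * (1 - \<beta> n)"
    using eventually_bounded_away_from_ends assms(16,18) by blast
  have \<beta>01: "\<beta> n \<in> {0..1}" for n using assms(11)[of n] by auto
  interpret
    alternating_iteration W C T U u \<alpha> \<beta> "\<lambda>n. x (2 * n)" "\<lambda>n. x (2 * n + 1)" b
  proof (intro alternating_iteration.intro alternating_iteration_axioms.intro)
    show "x (2 * 0) \<in> C" using assms(9,19) by simp
    show "x (2 * Suc n) = W (U (x (2 * n + 1))) (x (2 * n + 1)) (\<beta> n)" for n
      using assms(21)[of n] by (simp only: mult_Suc_right add.commute)
    show "summable (\<lambda>n. \<bar>\<alpha> (Suc n) - \<alpha> n\<bar>)" "summable (\<lambda>n. \<bar>\<beta> (Suc n) - \<beta> n\<bar>)"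
      using assms(14,15) by simp_all
  qed (fact assms b \<beta>01)+
  obtain p where p: "p \<in> Fix_on C T \<inter> Fix_on C U"
      "\<And>q. q \<in> Fix_on C T \<inter> Fix_on C U \<Longrightarrow> dist u p \<le> dist u q"
      "\<And>e. e > 0 \<Longrightarrow> \<exists>d>0. \<forall>x\<in>approx_common_fix C T U d. dist u p - e \<le> dist u x"
    using nearest_common_fixed_point[OF assms(1,3,4,5,6,7), of u] by blast
  have even: "(\<lambda>n. x (2 * n)) \<longlonglongrightarrow> p" using z_tendsto_nearest p(1,3) by blast
  moreover have "(\<lambda>n. x (2 * n + 1)) \<longlonglongrightarrow> p"
  proof (rule iffD2[OF tendsto_dist_iff tendsto_sandwich[OF _ _ tendsto_const]])
    show "\<forall>\<^sub>F n in sequentially.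
        dist (x (2 * n + 1)) p \<le> dist (x (2 * n)) (x (2 * n + 1)) + dist (x (2 * n)) p"
      by (simp add: dist_triangle3)
    show "(\<lambda>n. dist (x (2 * n)) (x (2 * n + 1)) + dist (x (2 * n)) p) \<longlonglongrightarrow> 0"
      using tendsto_add[OF dist_z_y_tendsto_zero iffD1[OF tendsto_dist_iff even]] by simp
  qed simp
  ultimately have "x \<longlonglongrightarrow> p" by (rule limseq_even_odd)
  moreover have "metric_projection (Fix_on C T \<inter> Fix_on C U) u = p"
    by (rule metric_projection_common_fix_eqI[OF T U C p(1,2)])
  ultimately show ?thesis by simp
qed

end
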